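(* Let $n\geq 1$ be an integer. For every integer $k$, the number of increasing integer sequences $1\leq a_1<a_2<\cdots<a_n\leq 2n$ whose sum $a_1+\cdots+a_n$ is congruent to $k$ modulo $2n-1$ is independent of $k$, and is equal to $\frac{1}{2n-1}\binom{2n}{n}$.
   Context: Increasing means strictly increasing; the bounds $1$ and $2n$ are inclusive. *)

theory Defs
  imports Complex_Main "HOL-Number_Theory.Cong"
begin

definition increasing_seqs :: "nat \<Rightarrow> int \<Rightarrow> int list set" where
  "increasing_seqs n k =
     {a. length a = n \<and> sorted_wrt (<) a \<and> set a \<subseteq> {1..2 * int n} \<and>
         [sum_list a = k] (mod (2 * int n - 1))}"

end

theory Submission
  imports Defs
begin

text \<open>
  Put \<open>N = 2n - 1\<close>. An increasing sequence is the same thing as the set of its entries, an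
  \<open>n\<close>-element subset of \<open>{1..N + 1}\<close>. The set \<open>{1..N}\<close> is a complete system of residues
  modulo \<open>N\<close>, so it can be rotated; the extra point \<open>N + 1\<close> is left fixed. Rotating by one step
  raises the sum of a subset by the number \<open>j\<close> of its elements in \<open>{1..N}\<close>, which is \<open>n\<close> or
  \<open>n - 1\<close> according to whether \<open>N + 1\<close> is absent or present. Both numbers are coprime to
  \<open>2n - 1\<close>, so in either family repeated rotation carries every residue class of sums into every
  other one, and the classes are equally large (\<open>card_subsets_with_sum\<close>). Hence \<open>N\<close> times the
  wanted number is \<open>(N choose n) + (N choose (n - 1)) = 2n choose n\<close>.
\<close>

definition subsets_with_sum :: "int \<Rightarrow> int set \<Rightarrow> nat \<Rightarrow> int \<Rightarrow> int set set" where
  "subsets_with_sum N A j k = {S. S \<subseteq> A \<and> card S = j \<and> [\<Sum>S = k] (mod N)}"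

lemma finite_subsets_with_sum: "finite A \<Longrightarrow> finite (subsets_with_sum N A j k)"
  by (rule finite_subset[of _ "Pow A"]) (auto simp: subsets_with_sum_def)

lemma card_increasing_seqs:
  "card (increasing_seqs n k) = card (subsets_with_sum (2 * int n - 1) {1..2 * int n} n k)"
proof (rule bij_betw_same_card[of set], rule bij_betwI')
  fix xs ys assume "xs \<in> increasing_seqs n k" "ys \<in> increasing_seqs n k"
  then show "(set xs = set ys) = (xs = ys)"
    by (auto simp: increasing_seqs_def intro: strict_sorted_equal)
next
  fix xs assume "xs \<in> increasing_seqs n k"
  then show "set xs \<in> subsets_with_sum (2 * int n - 1) {1..2 * int n} n k"
    by (auto simp: increasing_seqs_def subsets_with_sum_def strict_sorted_iff distinct_card
        distinct_sum_list_conv_Sum)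
next
  fix S assume S: "S \<in> subsets_with_sum (2 * int n - 1) {1..2 * int n} n k"
  then have "finite S"
    by (auto simp: subsets_with_sum_def intro: finite_subset)
  with S have "sorted_list_of_set S \<in> increasing_seqs n k"
    by (auto simp: increasing_seqs_def subsets_with_sum_def distinct_sum_list_conv_Sum)
  with \<open>finite S\<close> show "\<exists>xs \<in> increasing_seqs n k. S = set xs"
    by (metis sorted_list_of_set.set_sorted_key_list_of_set)
qed

text \<open>
  The rotation \<open>x \<mapsto> x mod N + 1\<close> sends \<open>N\<close> to \<open>1\<close> and every other element of \<open>{1..N}\<close> to its
  successor; it adds \<open>1\<close> modulo \<open>N\<close> to each of the \<open>j\<close> elements. Injectivity alone suffices
  here: the inequality is to be iterated around the cycle of residues.
\<close>

lemma card_subsets_with_sum_rotate: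
  assumes "N > 0"
  shows "card (subsets_with_sum N {1..N} j k) \<le> card (subsets_with_sum N {1..N} j (k + int j))"
proof -
  define rot where "rot x = x mod N + 1" for x :: int
  have inj: "inj_on rot {1..N}"
  proof (rule inj_onI)
    fix x y assume xy: "x \<in> {1..N}" "y \<in> {1..N}" "rot x = rot y"
    then have "N dvd x - y"
      by (simp add: rot_def mod_eq_dvd_iff)
    moreover have "\<bar>x - y\<bar> < N"
      using xy by auto
    ultimately show "x = y"
      using zdvd_imp_le[of N "\<bar>x - y\<bar>"] by fastforce
  qed
  have range: "rot x \<in> {1..N}" for x
    using pos_mod_bound[OF assms, of x] pos_mod_sign[OF assms, of x] by (auto simp: rot_def)
  have "(`) rot ` subsets_with_sum N {1..N} j k \<subseteq> subsets_with_sum N {1..N} j (k + int j)"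
  proof (rule image_subsetI)
    fix S assume "S \<in> subsets_with_sum N {1..N} j k"
    then have S: "S \<subseteq> {1..N}" "card S = j" "[\<Sum>S = k] (mod N)"
      by (auto simp: subsets_with_sum_def)
    have injS: "inj_on rot S"
      using inj S(1) by (rule inj_on_subset)
    have "\<Sum>(rot ` S) = (\<Sum>x\<in>S. x mod N) + int j"
      using S(2) by (subst sum.reindex[OF injS]) (simp add: rot_def sum.distrib)
    moreover have "[(\<Sum>x\<in>S. x mod N) = \<Sum>S] (mod N)"
      by (simp add: cong_def mod_sum_eq)
    ultimately have "[\<Sum>(rot ` S) = k + int j] (mod N)"
      using S(3) by (metis cong_add cong_refl cong_trans)
    then show "rot ` S \<in> subsets_with_sum N {1..N} j (k + int j)"
      using S(2) injS range by (auto simp: subsets_with_sum_def card_image)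
  qed
  moreover have "inj_on ((`) rot) (subsets_with_sum N {1..N} j k)"
    using inj by (intro inj_on_subset[OF inj_on_image_Pow])
      (auto simp: subsets_with_sum_def)
  ultimately show ?thesis
    by (intro card_inj_on_le) (auto intro: finite_subsets_with_sum)
qed

text \<open>
  As \<open>j\<close> is a unit modulo \<open>N\<close>, the residues \<open>k\<close>, \<open>k + j\<close>, \<open>k + 2j\<close> and so on reach every \<open>l\<close>.
  Exchanging \<open>k\<close> and \<open>l\<close> then turns the inequality into an equality.
\<close>

lemma card_subsets_with_sum_indep:
  assumes "N > 0" "coprime (int j) N"
  shows "card (subsets_with_sum N {1..N} j k) \<le> card (subsets_with_sum N {1..N} j l)"
proof -
  have iter: "card (subsets_with_sum N {1..N} j k)
      \<le> card (subsets_with_sum N {1..N} j (k + int t * int j))" for t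
  proof (induction t)
    case (Suc t)
    then show ?case
      using card_subsets_with_sum_rotate[OF assms(1), of j "k + int t * int j"]
      by (simp add: algebra_simps)
  qed simp
  obtain i where i: "[int j * i = 1] (mod N)"
    using assms(2) cong_solve_coprime_int by blast
  \<comment> \<open>The number of rotations that raises the sum by \<open>l - k\<close>, made nonnegative by reduction.\<close>
  define t where "t = nat ((i * (l - k)) mod N)"
  have "[int t * int j = i * (l - k) * int j] (mod N)"
    using assms(1) by (intro cong_mult) (auto simp: t_def cong_def)
  also have "i * (l - k) * int j = (int j * i) * (l - k)"
    by simp
  also have "[(int j * i) * (l - k) = 1 * (l - k)] (mod N)"
    by (intro cong_mult i cong_refl)
  finally have "[k + int t * int j = k + (l - k)] (mod N)"
    by (intro cong_add) auto
  then have "subsets_with_sum N {1..N} j (k + int t * int j) = subsets_with_sum N {1..N} j l"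
    by (auto simp: subsets_with_sum_def cong_def)
  then show ?thesis
    using iter[of t] by simp
qed

lemma card_subsets_with_sum:
  assumes "N > 0" "coprime (int j) N"
  shows "nat N * card (subsets_with_sum N {1..N} j k) = nat N choose j"
proof -
  have "nat N choose j = card {S. S \<subseteq> {1..N} \<and> card S = j}"
    by (simp add: n_subsets)
  also have "{S. S \<subseteq> {1..N} \<and> card S = j} = (\<Union>l\<in>{0..<N}. subsets_with_sum N {1..N} j l)"
    using assms(1) by (force simp: subsets_with_sum_def cong_def)
  also have "card \<dots> = (\<Sum>l\<in>{0..<N}. card (subsets_with_sum N {1..N} j l))"
    by (rule card_UN_disjoint)
      (auto simp: finite_subsets_with_sum subsets_with_sum_def cong_def)
  also have "\<dots> = (\<Sum>l\<in>{0..<N}. card (subsets_with_sum N {1..N} j k))"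
    by (intro sum.cong refl antisym card_subsets_with_sum_indep assms)
  finally show ?thesis
    by simp
qed

lemma card_subsets_with_sum_insert:
  assumes "finite A" "x \<notin> A"
  shows "card (subsets_with_sum N (insert x A) (Suc j) k)
    = card (subsets_with_sum N A (Suc j) k) + card (subsets_with_sum N A j (k - x))"
proof -
  have "subsets_with_sum N (insert x A) (Suc j) k
      = subsets_with_sum N A (Suc j) k \<union> insert x ` subsets_with_sum N A j (k - x)"
    (is "?L = ?R1 \<union> ?R2")
  proof (intro equalityI subsetI)
    fix S assume S: "S \<in> ?L"
    show "S \<in> ?R1 \<union> ?R2"
    proof (cases "x \<in> S")
      case True
      have fin: "finite S"
        using S assms(1) by (auto simp: subsets_with_sum_def intro: finite_subset)
      have "[\<Sum>S - x = k - x] (mod N)"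
        using S by (intro cong_diff) (auto simp: subsets_with_sum_def)
      then have "S - {x} \<in> subsets_with_sum N A j (k - x)"
        using S True fin by (auto simp: subsets_with_sum_def sum_diff1)
      then show ?thesis
        using True by (auto intro!: image_eqI[of _ _ "S - {x}"])
    qed (use S in \<open>auto simp: subsets_with_sum_def\<close>)
  next
    fix S assume "S \<in> ?R1 \<union> ?R2"
    then show "S \<in> ?L"
    proof
      assume "S \<in> ?R2"
      then obtain T where T: "S = insert x T" "T \<subseteq> A" "card T = j" "[\<Sum>T = k - x] (mod N)"
        by (auto simp: subsets_with_sum_def)
      then have "finite T" "x \<notin> T"
        using assms by (auto intro: finite_subset)
      moreover have "[x + \<Sum>T = x + (k - x)] (mod N)"
        using T(4) by (intro cong_add) auto
      ultimately show ?thesis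
        using T by (auto simp: subsets_with_sum_def)
    qed (auto simp: subsets_with_sum_def)
  qed
  moreover have "inj_on (insert x) (subsets_with_sum N A j (k - x))"
    using assms(2) by (intro inj_onI) (auto simp: subsets_with_sum_def insert_ident)
  moreover have "subsets_with_sum N A (Suc j) k \<inter> insert x ` subsets_with_sum N A j (k - x) = {}"
    using assms(2) by (auto simp: subsets_with_sum_def)
  ultimately show ?thesis
    using assms(1) by (simp add: card_Un_disjoint card_image finite_subsets_with_sum)
qed

lemma card_increasing_seqs_mult:
  assumes "n \<ge> 1"
  shows "(2 * n - 1) * card (increasing_seqs n k) = (2 * n) choose n"
proof -
  obtain j where n: "n = Suc j"
    using assms by (cases n) auto
  define N where "N = 2 * int n - 1"
  have N: "N > 0" "nat N = Suc (2 * j)"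
    by (auto simp: N_def n)
  \<comment> \<open>Bezout: \<open>2 * n - N = 1\<close> and \<open>N - 2 * (n - 1) = 1\<close>.\<close>
  have "coprime (int (Suc j)) N"
  proof (rule coprimeI)
    fix d assume "d dvd int (Suc j)" "d dvd N"
    then have "d dvd 2 * int (Suc j) - N"
      by (intro dvd_diff dvd_mult)
    then show "d dvd 1"
      by (simp add: N_def n)
  qed
  moreover have "coprime (int j) N"
  proof (rule coprimeI)
    fix d assume "d dvd int j" "d dvd N"
    then have "d dvd N - 2 * int j"
      by (intro dvd_diff dvd_mult)
    then show "d dvd 1"
      by (simp add: N_def n)
  qed
  moreover have "{1..2 * int n} = insert (2 * int n) {1..N}"
    by (auto simp: N_def n)
  then have "card (increasing_seqs n k) = card (subsets_with_sum N {1..N} (Suc j) k)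
      + card (subsets_with_sum N {1..N} j (k - 2 * int n))"
    using card_subsets_with_sum_insert[of "{1..N}" "2 * int n" N j k]
    by (simp add: card_increasing_seqs N_def n)
  ultimately have "nat N * card (increasing_seqs n k) = (nat N choose Suc j) + (nat N choose j)"
    using N(1) by (simp add: add_mult_distrib2 card_subsets_with_sum)
  then show ?thesis
    by (simp add: N(2) n)
qed

theorem theorem3:
  fixes n :: nat
  assumes "n \<ge> 1"
  shows "(\<forall>k l :: int. card (increasing_seqs n k) = card (increasing_seqs n l)) \<and>
         (\<forall>k :: int. real (card (increasing_seqs n k)) =
            1 / (2 * real n - 1) * real ((2 * n) choose n))"
proof -
  have "real (card (increasing_seqs n k)) = 1 / (2 * real n - 1) * real ((2 * n) choose n)" for k
  proof -
    have "real (2 * n - 1) * real (card (increasing_seqs n k)) = real ((2 * n) choose n)"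
      by (simp only: card_increasing_seqs_mult[OF assms] flip: of_nat_mult)
    then show ?thesis
      using assms by (simp add: field_simps of_nat_diff)
  qed
  then show ?thesis
    by (metis of_nat_eq_iff)
qed

end
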